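(* Let $v_n$ be the maximum expected length of an increasing subsequence that can be selected by an online (non-anticipating) policy from $n$ independent random variables $X_1,\dots,X_n$ uniformly distributed on $[0,1]$. Then $$v_n=\sqrt{2n}-\frac{1}{12}\log n+O(1)\qquad\text{as } n\to\infty,$$ i.e. $\sup_{n\ge 1}\left|v_n-\sqrt{2n}+\frac{1}{12}\log n\right|<\infty$.
   Context: Online selection problem with fixed sample size $n$: items $X_1,\dots,X_n$, i.i.d. uniform on $[0,1]$, are observed one at a time. At time $i$, upon observing $X_i$, the decision maker must irrevocably accept or reject $X_i$, using only the information in $X_1,\dots,X_i$; the accepted items must form an increasing sequence. Formally, a policy is a sequence of stopping times $\tau_1<\tau_2<\cdots$ (with value $\infty$ if no further selection is made) with respect to the filtration generated by $X_1,X_2,\dots,X_n$, such that $X_{\tau_1}<X_{\tau_2}<\cdots$ along the finite stopping times. The length of the selected subsequence is $\max\{j:\tau_j\le n\}$ (and $0$ if no item is selected), and $v_n$ is the maximum of its expectation over all policies. For $z\in[0,1]$ let $v_k(z)$ be the maximum expected length in the problem with $k$ items when only items bigger than $z$ may be selected, so that $v_n=v_n(0)$. It is known that these functions are determined by the dynamic programming recursion $$v_k(z)=z\,v_{k-1}(z)+\int_z^1\max\{v_{k-1}(x)+1,\;v_{k-1}(z)\}\,\mathrm{d}x,\qquad k\ge 1,\qquad v_0(z)=0.$$ *)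

theory Defs
  imports "HOL-Probability.Probability"
begin

text \<open>
  The items are \<open>X 1, \<dots>, X n\<close>.  Times are extended natural numbers, the value \<open>\<infinity>\<close> of a
  stopping time meaning that the corresponding selection is never made.
\<close>

definition item_filtration ::
    "'a measure \<Rightarrow> (nat \<Rightarrow> 'a \<Rightarrow> real) \<Rightarrow> nat \<Rightarrow> enat \<Rightarrow> 'a measure" where
  "item_filtration M X n t =
     sigma (space M) {X i -` B \<inter> space M | i B. i \<in> {1..n} \<and> enat i \<le> t \<and> B \<in> sets borel}"

text \<open>
  The stopping times are \<open>\<tau> 1, \<tau> 2, \<dots>\<close>; the value of \<open>\<tau> 0\<close> is irrelevant.
  Strict monotonicity is required as long as the times are finite; once a time is \<open>\<infinity>\<close>,
  so are all later ones.
\<close>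

definition selection_policy ::
    "'a measure \<Rightarrow> (nat \<Rightarrow> 'a \<Rightarrow> real) \<Rightarrow> nat \<Rightarrow> (nat \<Rightarrow> 'a \<Rightarrow> enat) \<Rightarrow> bool" where
  "selection_policy M X n \<tau> \<longleftrightarrow>
     (\<forall>j\<ge>1. stopping_time (item_filtration M X n) (\<tau> j)) \<and>
     (\<forall>j\<ge>1. \<forall>\<omega>\<in>space M. \<tau> j \<omega> \<in> enat ` {1..n} \<union> {\<infinity>}) \<and>
     (\<forall>j\<ge>1. \<forall>\<omega>\<in>space M. \<tau> j \<omega> < \<tau> (Suc j) \<omega> \<or> (\<tau> j \<omega> = \<infinity> \<and> \<tau> (Suc j) \<omega> = \<infinity>)) \<and>
     (\<forall>j\<ge>1. \<forall>\<omega>\<in>space M. \<tau> (Suc j) \<omega> \<noteq> \<infinity> \<longrightarrow>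
        X (the_enat (\<tau> j \<omega>)) \<omega> < X (the_enat (\<tau> (Suc j) \<omega>)) \<omega>)"

definition selected_length :: "nat \<Rightarrow> (nat \<Rightarrow> 'a \<Rightarrow> enat) \<Rightarrow> 'a \<Rightarrow> nat" where
  "selected_length n \<tau> \<omega> = Max (insert 0 {j. 1 \<le> j \<and> \<tau> j \<omega> \<le> enat n})"

definition max_expected_length :: "'a measure \<Rightarrow> (nat \<Rightarrow> 'a \<Rightarrow> real) \<Rightarrow> nat \<Rightarrow> real" where
  "max_expected_length M X n =
     (SUP \<tau>\<in>{\<tau>. selection_policy M X n \<tau>}. \<integral>\<omega>. real (selected_length n \<tau> \<omega>) \<partial>M)"

definition iid_uniform_items :: "'a measure \<Rightarrow> (nat \<Rightarrow> 'a \<Rightarrow> real) \<Rightarrow> nat \<Rightarrow> bool" where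
  "iid_uniform_items M X n \<longleftrightarrow>
     prob_space M \<and>
     prob_space.indep_vars M (\<lambda>_. borel) X {1..n} \<and>
     (\<forall>i\<in>{1..n}. distr M borel (X i) = uniform_measure lborel {0..1})"

end

theory Submission
  imports Defs "HOL-Real_Asymp.Real_Asymp"
begin

text \<open>
  For every policy, the expected number of items accepted up to time \<open>i\<close> plus the value \<open>v\<^bsub>n-i\<^esub>\<close> at the last
  accepted item is nonincreasing in \<open>i\<close>, and for the greedy policy of the dynamic programming recursion it is
  constant; hence the optimal value is \<open>v\<^sub>n(0)\<close>.

  The gain \<open>B f z - f z\<close> of the Bellman operator \<open>B\<close> depends only on the increments of \<open>f\<close> and is
  monotone in them. With \<open>r = sqrt (2 k (1 - z))\<close>, the gain of \<open>a r\<close> is exactly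
  \<open>(r / (2 a) - 1 / (6 a\<^sup>2)) / k\<close> if \<open>1 / a < r\<close>, so the gain of a convex function \<open>\<psi>(r)\<close> is
  controlled by the slopes of \<open>\<psi>\<close> at \<open>r\<close> and slightly below. For \<open>\<psi>(r) = r + h(r)\<close> the recursion
  reads, to leading order, \<open>r h'(r) / 2 = - 1/6 - r h'(r) / 2\<close>, so \<open>h = - ln r / 6\<close>, which is
  where \<open>- ln n / 12\<close> comes from. The remaining errors in \<open>h'\<close> are of order \<open>r\<^sup>-\<^sup>2\<close>, those of the
  discretisation in \<open>k\<close> included, and a correction \<open>\<mp> 1/r\<close> turns \<open>\<psi>\<close> into a super- or subsolution.
\<close>

section \<open>The dynamic programming recursion\<close>

definition choice_value :: "(real \<Rightarrow> real) \<Rightarrow> real \<Rightarrow> real \<Rightarrow> real" where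
  "choice_value f z x = (if z < x then max (f x + 1) (f z) else f z)"

definition bellman :: "real measure \<Rightarrow> (real \<Rightarrow> real) \<Rightarrow> real \<Rightarrow> real" where
  "bellman D f z = (\<integral>x. choice_value f z x \<partial>D)"

primrec opt_value :: "real measure \<Rightarrow> nat \<Rightarrow> real \<Rightarrow> real" where
  "opt_value D 0 = (\<lambda>z. 0)"
| "opt_value D (Suc k) = bellman D (opt_value D k)"

lemma measurable_choice_value [measurable]:
  assumes [measurable]: "f \<in> borel_measurable borel"
    and [measurable]: "g \<in> borel_measurable M" "h \<in> borel_measurable M"
  shows "(\<lambda>\<omega>. choice_value f (g \<omega>) (h \<omega>)) \<in> borel_measurable M"
  unfolding choice_value_def by measurable

lemma abs_choice_value_le:
  assumes "\<And>x. \<bar>f x\<bar> \<le> B"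
  shows "\<bar>choice_value f z x\<bar> \<le> B + 1"
  using assms[of x] assms[of z] by (auto simp: choice_value_def)

lemma choice_value_add_const: "choice_value (\<lambda>x. c + f x) z x = c + choice_value f z x"
  by (simp add: choice_value_def add.assoc max_add_distrib_right)

context real_distribution
begin

lemma integrable_choice_value:
  assumes "integrable M f"
  shows "integrable M (choice_value f z)"
proof -
  have "choice_value f z = (\<lambda>x. f z + max 0 (f x + 1 - f z) * indicator {z<..} x)"
    by (auto simp: choice_value_def fun_eq_iff)
  moreover have "integrable M (\<lambda>x. max 0 (f x + 1 - f z) * indicator {z<..} x)"
    using assms by (intro integrable_real_mult_indicator integrable_max) auto
  ultimately show ?thesis
    by simp
qed

lemma bellman_add_const:
  assumes "integrable M f"
  shows "bellman M (\<lambda>x. c + f x) z = c + bellman M f z"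
  using integrable_choice_value[OF assms, of z] prob_space
  by (simp add: bellman_def choice_value_add_const)

lemma bellman_gain_mono:
  assumes "integrable M f" "integrable M g"
    and "AE x in M. z < x \<longrightarrow> f x - f z \<le> max (- 1) (g x - g z)"
  shows "bellman M f z - f z \<le> bellman M g z - g z"
proof -
  have "bellman M f z \<le> (\<integral>x. (f z - g z) + choice_value g z x \<partial>M)"
    unfolding bellman_def
  proof (rule integral_mono_AE)
    show "AE x in M. choice_value f z x \<le> (f z - g z) + choice_value g z x"
      using assms(3) by eventually_elim (auto simp: choice_value_def max_def split: if_splits)
  qed (use assms integrable_choice_value in auto)
  also have "\<dots> = (f z - g z) + bellman M g z"
    using integrable_choice_value[OF assms(2), of z] prob_space by (simp add: bellman_def)
  finally show ?thesis
    by simp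
qed

lemma bellman_mono:
  assumes "integrable M f" "integrable M g"
    and "AE x in M. f x \<le> g x" "f z \<le> g z"
  shows "bellman M f z \<le> bellman M g z"
  unfolding bellman_def
proof (rule integral_mono_AE)
  show "AE x in M. choice_value f z x \<le> choice_value g z x"
    using assms(3) by eventually_elim (use assms(4) in \<open>auto simp: choice_value_def\<close>)
qed (use assms integrable_choice_value in auto)

lemma measurable_bellman [measurable]:
  assumes [measurable]: "f \<in> borel_measurable borel"
  shows "bellman M f \<in> borel_measurable borel"
  unfolding bellman_def [abs_def]
  by (rule borel_measurable_lebesgue_integral) (simp add: split_beta')

lemma measurable_opt_value [measurable]: "opt_value M k \<in> borel_measurable borel"
  by (induction k) simp_all

lemma opt_value_bounds: "0 \<le> opt_value M k z" "opt_value M k z \<le> real k"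
proof -
  have "0 \<le> opt_value M k z \<and> opt_value M k z \<le> real k"
  proof (induction k arbitrary: z)
    case (Suc k)
    have bounds: "0 \<le> choice_value (opt_value M k) z x" "choice_value (opt_value M k) z x \<le> 1 + real k" for x
      using Suc[of x] Suc[of z] by (auto simp: choice_value_def)
    have "integrable M (opt_value M k)"
      using Suc by (intro integrable_const_bound[where B = k]) auto
    from integrable_choice_value[OF this] show ?case
      using integral_le_const[of "choice_value (opt_value M k) z" "real (Suc k)"]
        integral_ge_const[of "choice_value (opt_value M k) z" 0] bounds
      by (auto simp: bellman_def)
  qed simp
  then show "0 \<le> opt_value M k z" "opt_value M k z \<le> real k"
    by auto
qed

lemma abs_opt_value_le: "\<bar>opt_value M k z\<bar> \<le> real k"
  using opt_value_bounds[of k z] by simp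

lemma integrable_opt_value: "integrable M (opt_value M k)"
  by (rule integrable_const_bound[where B = k]) (auto simp: abs_opt_value_le)

lemma opt_value_le_prob: "opt_value M k z \<le> real k * prob {z<..}"
proof (induction k arbitrary: z)
  case (Suc k)
  have int: "integrable M (\<lambda>x. real k * prob {z<..} + indicator {z<..} x)"
    by (intro Bochner_Integration.integrable_add) (auto simp: integrable_indicator_iff less_top[symmetric])
  have "opt_value M (Suc k) z \<le> (\<integral>x. real k * prob {z<..} + indicator {z<..} x \<partial>M)"
    unfolding opt_value.simps bellman_def
  proof (rule integral_mono[OF integrable_choice_value[OF integrable_opt_value] int])
    fix x
    have "real k * prob {x<..} \<le> real k * prob {z<..}" if "z < x"
      using that by (intro mult_left_mono finite_measure_mono) auto
    then show "choice_value (opt_value M k) z x \<le> real k * prob {z<..} + indicator {z<..} x"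
      using Suc.IH[of x] Suc.IH[of z] by (auto simp: choice_value_def)
  qed
  also have "\<dots> = real (Suc k) * prob {z<..}"
    using prob_space by (subst Bochner_Integration.integral_add) (auto simp: algebra_simps less_top[symmetric])
  finally show ?case .
qed simp

lemma opt_value_le_supersolution:
  assumes S: "AE x in M. x \<in> S" and int: "\<And>k. integrable M (g k)"
    and init: "\<And>z. z \<in> S \<Longrightarrow> 0 \<le> g 0 z"
    and step: "\<And>k z. z \<in> S \<Longrightarrow> opt_value M (Suc k) z \<le> g (Suc k) z \<or> bellman M (g k) z \<le> g (Suc k) z"
    and z: "z \<in> S"
  shows "opt_value M k z \<le> g k z"
  using z
proof (induction k arbitrary: z)
  case (Suc k)
  have "AE x in M. opt_value M k x \<le> g k x"
    using S by eventually_elim (rule Suc.IH)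
  then have "bellman M (opt_value M k) z \<le> bellman M (g k) z"
    using Suc.IH[OF Suc.prems] by (intro bellman_mono integrable_opt_value int)
  with step[OF Suc.prems, of k] show ?case
    by auto
qed (use init in simp)

lemma opt_value_ge_subsolution:
  assumes S: "AE x in M. x \<in> S" and int: "\<And>k. integrable M (g k)"
    and init: "\<And>z. z \<in> S \<Longrightarrow> g 0 z \<le> 0"
    and step: "\<And>k z. z \<in> S \<Longrightarrow> g (Suc k) z \<le> opt_value M (Suc k) z \<or> g (Suc k) z \<le> bellman M (g k) z"
    and z: "z \<in> S"
  shows "g k z \<le> opt_value M k z"
  using z
proof (induction k arbitrary: z)
  case (Suc k)
  have "AE x in M. g k x \<le> opt_value M k x"
    using S by eventually_elim (rule Suc.IH)
  then have "bellman M (g k) z \<le> bellman M (opt_value M k) z"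
    using Suc.IH[OF Suc.prems] by (intro bellman_mono integrable_opt_value int)
  with step[OF Suc.prems, of k] show ?case
    by auto
qed (use init in simp)

end

section \<open>The uniform distribution on the unit interval\<close>

abbreviation unif01 :: "real measure" where
  "unif01 \<equiv> uniform_measure lborel {0..1}"

interpretation unif01: real_distribution unif01
  by (intro real_distribution.intro real_distribution_axioms.intro prob_space_uniform_measure) auto

lemma unif01_eq_density: "unif01 = density lborel (\<lambda>x. ennreal (indicator {0..1} x))"
  unfolding uniform_measure_def
  by (intro arg_cong2[of _ _ _ _ density] refl ext) (auto split: split_indicator)

lemma integral_unif01:
  fixes f :: "real \<Rightarrow> real"
  assumes "f \<in> borel_measurable borel"
  shows "integral\<^sup>L unif01 f = (LBINT x:{0..1}. f x)"
  using assms by (simp add: unif01_eq_density integral_density set_lebesgue_integral_def)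

lemma integrable_unif01_continuous:
  fixes f :: "real \<Rightarrow> real"
  assumes "continuous_on UNIV f"
  shows "integrable unif01 f"
proof -
  have "f \<in> borel_measurable borel"
    using assms by (rule borel_measurable_continuous_onI)
  moreover have "set_integrable lborel {0..1} f"
    using assms by (intro borel_integrable_atLeastAtMost') (auto intro: continuous_on_subset)
  ultimately show ?thesis
    by (simp add: unif01_eq_density integrable_density set_integrable_def)
qed

lemma AE_unif01: "AE x in unif01. x \<in> {0<..1}"
proof -
  have "AE x in lborel. x \<noteq> (0::real)"
    by (rule AE_lborel_singleton)
  then have "AE x in lborel. x \<in> {0..1} \<longrightarrow> x \<in> {0<..1::real}"
    by eventually_elim auto
  then show ?thesis
    by (intro AE_uniform_measureI) auto
qed

lemma prob_unif01_greaterThan: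
  assumes "z \<in> {0..1}"
  shows "unif01.prob {z<..} = 1 - z"
proof -
  have "{0..1} \<inter> {z<..} = {z<..1}"
    using assms by auto
  then show ?thesis
    using assms by simp
qed

section \<open>The leading term\<close>

definition leading_term :: "nat \<Rightarrow> real \<Rightarrow> real" where
  "leading_term k z = sqrt (2 * real k * (1 - z))"

lemma leading_term_0 [simp]: "leading_term 0 z = 0"
  by (simp add: leading_term_def)

lemma leading_term_power2: "z \<le> 1 \<Longrightarrow> (leading_term k z)\<^sup>2 = 2 * real k * (1 - z)"
  by (simp add: leading_term_def)

lemma leading_term_antimono: "x \<le> y \<Longrightarrow> leading_term k y \<le> leading_term k x"
  unfolding leading_term_def by (intro real_sqrt_le_mono mult_left_mono) auto

lemma leading_term_less_iff: "k \<ge> 1 \<Longrightarrow> leading_term k x < leading_term k y \<longleftrightarrow> y < x"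
  by (auto simp: leading_term_def)

lemma continuous_on_leading_term [continuous_intros]: "continuous_on S (leading_term k)"
  unfolding leading_term_def [abs_def] by (intro continuous_intros)

lemma integrable_leading_term: "integrable unif01 (leading_term k)"
  by (intro integrable_unif01_continuous continuous_on_leading_term)

lemma DERIV_leading_term:
  assumes "k \<ge> 1" "x < 1"
  shows "(leading_term k has_real_derivative - real k / leading_term k x) (at x)"
  unfolding leading_term_def [abs_def]
  using assms by (auto intro!: derivative_eq_intros simp: field_simps)

lemma leading_term_Suc_bounds:
  assumes z: "z \<in> {0..1}" and pos: "leading_term k z > 0"
  shows "leading_term k z \<le> leading_term (Suc k) z"
    and "leading_term (Suc k) z \<le> leading_term k z + 1 / leading_term k z"
proof -
  let ?r = "leading_term k z" and ?q = "leading_term (Suc k) z"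
  show "?r \<le> ?q"
    unfolding leading_term_def using z by (intro real_sqrt_le_mono mult_right_mono) auto
  have "?q\<^sup>2 = ?r\<^sup>2 + 2 * (1 - z) + 0"
    using z by (simp add: leading_term_power2 algebra_simps)
  also have "\<dots> \<le> ?r\<^sup>2 + 2 + (1 / ?r)\<^sup>2"
    using z by (intro add_mono) auto
  also have "\<dots> = (?r + 1 / ?r)\<^sup>2"
    using pos by (simp add: power2_sum)
  finally show "?q \<le> ?r + 1 / ?r"
    by (rule power2_le_imp_le) (use pos in simp)
qed

lemma leading_term_Suc_diff:
  assumes z: "z \<in> {0..1}" and pos: "leading_term k z > 0"
  shows "leading_term (Suc k) z - leading_term k z
    = (leading_term k z)\<^sup>2 / (leading_term (Suc k) z + leading_term k z) / real k"
proof -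
  let ?r = "leading_term k z" and ?q = "leading_term (Suc k) z"
  have "k \<noteq> 0"
    using pos by (intro notI) simp
  have "?q + ?r > 0"
    using leading_term_Suc_bounds(1)[OF assms] pos by linarith
  then have "?q - ?r = (?q\<^sup>2 - ?r\<^sup>2) / (?q + ?r)"
    by (simp add: eq_divide_eq power2_eq_square algebra_simps)
  also have "?q\<^sup>2 - ?r\<^sup>2 = 2 * (1 - z)"
    using z by (simp add: leading_term_power2 algebra_simps)
  also have "\<dots> = ?r\<^sup>2 / real k"
    using z \<open>k \<noteq> 0\<close> by (simp add: leading_term_power2)
  finally show ?thesis
    by (simp add: mult.commute)
qed

lemma leading_term_ge_of_Suc:
  assumes z: "z \<in> {0..1}" and R: "R + 1 < leading_term (Suc k) z" "R \<ge> 1"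
  shows "R \<le> leading_term k z"
proof -
  have "R\<^sup>2 \<le> (R + 1)\<^sup>2 - 2"
    using R(2) by (simp add: power2_eq_square algebra_simps)
  also have "\<dots> \<le> (leading_term (Suc k) z)\<^sup>2 - 2"
    using R by (intro diff_right_mono power_mono) auto
  also have "\<dots> \<le> (leading_term k z)\<^sup>2"
    using z by (simp add: leading_term_power2 algebra_simps)
  finally show ?thesis
    by (rule power2_le_imp_le) (use z in \<open>simp add: leading_term_def\<close>)
qed

lemma opt_value_unif01_le:
  assumes "z \<in> {0..1}"
  shows "opt_value unif01 k z \<le> (leading_term k z)\<^sup>2 / 2"
  using unif01.opt_value_le_prob[of k z] assms
  unfolding prob_unif01_greaterThan[OF assms] by (simp add: leading_term_power2)

lemma interval_integral_comp_leading_term: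
  assumes k: "k \<ge> 1" and le: "z \<le> z'" and less: "z' < 1"
    and h: "continuous_on {leading_term k z'..leading_term k z} h"
    and P: "\<And>s. s \<in> {leading_term k z'..leading_term k z} \<Longrightarrow>
              (P has_real_derivative h s * s) (at s)"
  shows "(LBINT x=z..z'. h (leading_term k x)) = (P (leading_term k z) - P (leading_term k z')) / real k"
proof -
  have range: "leading_term k x \<in> {leading_term k z'..leading_term k z}" if "x \<in> {z..z'}" for x
    using that by (auto intro: leading_term_antimono)
  have cont: "continuous_on {z..z'} (\<lambda>x. h (leading_term k x))"
    using range by (intro continuous_on_compose2[OF h] continuous_intros) auto
  have "((\<lambda>x. - P (leading_term k x) / real k) has_real_derivative h (leading_term k x)) (at x)"
    if x: "x \<in> {z..z'}" for x
  proof -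
    have "leading_term k x \<noteq> 0"
      using k x less by (simp add: leading_term_def)
    moreover have "x < 1"
      using x less by simp
    ultimately show ?thesis
      using k by (auto intro!: derivative_eq_intros DERIV_chain2[OF P[OF range[OF x]] DERIV_leading_term])
  qed
  then have "((\<lambda>x. - P (leading_term k x) / real k) has_vector_derivative h (leading_term k x))
      (at x within {z..z'})" if "z \<le> x" "x \<le> z'" for x
    using that by (simp add: has_real_derivative_iff_has_vector_derivative[symmetric] has_field_derivative_at_within)
  then show ?thesis
    using cont le
    by (subst interval_integral_FTC_finite[where F = "\<lambda>x. - P (leading_term k x) / real k"])
      (auto simp: diff_divide_distrib)
qed

definition linear_gain :: "real \<Rightarrow> real \<Rightarrow> real" where
  "linear_gain a r = r / (2 * a) - 1 / (6 * a\<^sup>2)"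

lemma interval_integral_linear_leading_term:
  assumes k: "k \<ge> 1" and z: "z \<le> z'" "z' < 1" and a: "a > 0"
    and r: "leading_term k z = r" "leading_term k z' = r - 1 / a"
  shows "(LBINT x=z..z'. 1 - a * (r - leading_term k x)) = linear_gain a r / real k"
proof -
  define Q where "Q u = r * u - (1 + a * r) * u\<^sup>2 / 2 + a * u ^ 3 / 3" for u
  have "(Q has_real_derivative (1 - a * u) * (r - u)) (at u)" for u
    unfolding Q_def [abs_def]
    by (auto intro!: derivative_eq_intros simp: field_simps power2_eq_square)
  then have "((\<lambda>s. Q (r - s)) has_real_derivative (1 - a * (r - s)) * (r - (r - s)) * (- 1)) (at s)" for s
    by (rule DERIV_chain2) (auto intro!: derivative_eq_intros)
  from DERIV_minus[OF this]
  have deriv: "((\<lambda>s. - Q (r - s)) has_real_derivative (1 - a * (r - s)) * s) (at s)" for s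
    by simp
  have "(LBINT x=z..z'. 1 - a * (r - leading_term k x)) = (Q (1 / a) - Q 0) / real k"
    using interval_integral_comp_leading_term[OF k z, of "\<lambda>s. 1 - a * (r - s)", OF _ deriv] r
    by (simp add: continuous_intros)
  also have "Q (1 / a) - Q 0 = linear_gain a r"
    using a by (simp add: Q_def linear_gain_def field_simps power2_eq_square power3_eq_cube)
  finally show ?thesis .
qed

lemma leading_term_eqE:
  assumes "k \<ge> 1" "0 < s"
  obtains z where "z < 1" "leading_term k z = s"
proof
  show "1 - s\<^sup>2 / (2 * real k) < 1" "leading_term k (1 - s\<^sup>2 / (2 * real k)) = s"
    using assms by (auto simp: leading_term_def)
qed

text \<open>
  The next item is accepted up to the point \<open>z'\<close> at which \<open>a * leading_term k\<close> has dropped by 1.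
\<close>

lemma choice_value_linear_leading_term:
  assumes k: "k \<ge> 1" and a: "a > 0" and z': "leading_term k z' = leading_term k z - 1 / a"
  shows "choice_value (\<lambda>x. a * leading_term k x) z x
    = a * leading_term k z + indicator {z<..<z'} x * (1 - a * (leading_term k z - leading_term k x))"
proof -
  have "0 < 1 - a * (leading_term k z - leading_term k x) \<longleftrightarrow> leading_term k z' < leading_term k x"
    using a by (simp add: z' field_simps)
  also have "\<dots> \<longleftrightarrow> x < z'"
    using k by (rule leading_term_less_iff)
  finally show ?thesis
    by (auto simp: choice_value_def max_def algebra_simps split: split_indicator)
qed

lemma bellman_linear_leading_term:
  assumes k: "k \<ge> 1" and z: "z \<in> {0..1}" and a: "a > 0" and less: "1 / a < leading_term k z"
  shows "bellman unif01 (\<lambda>x. a * leading_term k x) z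
    = a * leading_term k z + linear_gain a (leading_term k z) / real k"
proof -
  define r where "r = leading_term k z"
  define h where "h x = 1 - a * (r - leading_term k x)" for x
  obtain z' where z': "z' < 1" and drop: "leading_term k z' = r - 1 / a"
    using leading_term_eqE[OF k, of "r - 1 / a"] less by (auto simp: r_def)
  have zz': "z < z'"
    using leading_term_less_iff[OF k, of z' z] a drop by (simp add: r_def)
  have [measurable]: "h \<in> borel_measurable borel"
    unfolding h_def [abs_def] by (intro borel_measurable_continuous_onI continuous_intros)
  have "integrable unif01 h"
    unfolding h_def [abs_def] by (intro integrable_unif01_continuous continuous_intros)
  then have int: "integrable unif01 (\<lambda>x. indicator {z<..<z'} x * h x)"
    using integrable_real_mult_indicator[of "{z<..<z'}" unif01 h] by (simp add: mult.commute)
  have "choice_value (\<lambda>x. a * leading_term k x) z = (\<lambda>x. a * r + indicator {z<..<z'} x * h x)"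
    using choice_value_linear_leading_term[OF k a drop[unfolded r_def]] unfolding h_def r_def by (rule ext)
  then have "bellman unif01 (\<lambda>x. a * leading_term k x) z
      = (\<integral>x. a * r + indicator {z<..<z'} x * h x \<partial>unif01)"
    by (simp add: bellman_def)
  also have "\<dots> = a * r + (LBINT x:{0..1}. indicator {z<..<z'} x * h x)"
    using int unif01.prob_space by (simp add: integral_unif01)
  also have "(LBINT x:{0..1}. indicator {z<..<z'} x * h x) = (LBINT x=z..z'. h x)"
    using z z' zz' unfolding set_lebesgue_integral_def
    by (subst interval_integral_Ioo)
      (auto simp: set_lebesgue_integral_def intro!: Bochner_Integration.integral_cong split: split_indicator)
  also have "\<dots> = linear_gain a r / real k"
    unfolding h_def
    by (rule interval_integral_linear_leading_term[OF k less_imp_le[OF zz'] z' a _ drop]) (simp add: r_def)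
  finally show ?thesis
    by (simp add: r_def)
qed

section \<open>Convex functions of the leading term\<close>

locale convex_profile =
  fixes \<psi> \<psi>' :: "real \<Rightarrow> real" and \<rho> :: real
  assumes threshold_pos: "0 < \<rho>"
    and DERIV_profile: "\<And>r. \<rho> \<le> r \<Longrightarrow> (\<psi> has_real_derivative \<psi>' r) (at r)"
    and deriv_mono: "\<And>s r. \<rho> \<le> s \<Longrightarrow> s \<le> r \<Longrightarrow> \<psi>' s \<le> \<psi>' r"
    and deriv_ge_half: "\<And>r. \<rho> \<le> r \<Longrightarrow> 1 / 2 \<le> \<psi>' r"
begin

definition profile :: "nat \<Rightarrow> real \<Rightarrow> real" where
  "profile k z = \<psi> (max \<rho> (leading_term k z))"

lemma profile_eq: "\<rho> \<le> leading_term k z \<Longrightarrow> profile k z = \<psi> (leading_term k z)"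
  by (simp add: profile_def max_absorb2)

lemma
  assumes "\<rho> \<le> s" "s \<le> r"
  shows increment_ge: "\<psi>' s * (r - s) \<le> \<psi> r - \<psi> s"
    and increment_le: "\<psi> r - \<psi> s \<le> \<psi>' r * (r - s)"
proof -
  have "\<psi>' s * (r - s) \<le> \<psi> r - \<psi> s \<and> \<psi> r - \<psi> s \<le> \<psi>' r * (r - s)"
  proof (cases "s = r")
    case False
    then have "\<exists>x>s. x < r \<and> \<psi> r - \<psi> s = (r - s) * \<psi>' x"
      using assms by (intro MVT2) (auto intro: DERIV_profile)
    then obtain x where x: "s < x" "x < r" and eq: "\<psi> r - \<psi> s = \<psi>' x * (r - s)"
      by (auto simp: mult.commute)
    have "\<psi>' s \<le> \<psi>' x" "\<psi>' x \<le> \<psi>' r"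
      using x assms by (auto intro: deriv_mono)
    then show ?thesis
      unfolding eq using assms by (auto intro: mult_right_mono)
  qed simp
  then show "\<psi>' s * (r - s) \<le> \<psi> r - \<psi> s" "\<psi> r - \<psi> s \<le> \<psi>' r * (r - s)"
    by auto
qed

lemma increment_ge_half: "\<rho> \<le> s \<Longrightarrow> s \<le> r \<Longrightarrow> (r - s) / 2 \<le> \<psi> r - \<psi> s"
  using increment_ge[of s r] mult_right_mono[OF deriv_ge_half, of s "r - s"] by simp

lemma profile_mono: "\<rho> \<le> s \<Longrightarrow> s \<le> r \<Longrightarrow> \<psi> s \<le> \<psi> r"
  using increment_ge_half[of s r] by simp

lemma integrable_profile: "integrable unif01 (profile k)"
proof (rule integrable_unif01_continuous)
  have "continuous_on {\<rho>..} \<psi>"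
    by (auto intro!: DERIV_isCont continuous_at_imp_continuous_on DERIV_profile)
  then show "continuous_on UNIV (profile k)"
    unfolding profile_def [abs_def] by (rule continuous_on_compose2) (auto intro!: continuous_intros)
qed

lemma truncated_drop_le:
  assumes r: "\<rho> + 2 \<le> r" and s: "s \<le> r"
  shows "\<psi> (max \<rho> s) - \<psi> r \<le> max (- 1) (\<psi>' (r - 2) * (s - r))"
proof (cases "r - 2 \<le> s")
  case True
  then have "\<psi>' (r - 2) * (r - s) \<le> \<psi>' s * (r - s)"
    using r s by (intro mult_right_mono deriv_mono) auto
  also have "\<dots> \<le> \<psi> r - \<psi> s"
    using True r s by (intro increment_ge) auto
  finally show ?thesis
    using True r by (simp add: max_absorb2 algebra_simps)
next
  case False
  then have "\<psi> (max \<rho> s) \<le> \<psi> (r - 2)"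
    using r by (intro profile_mono) auto
  with increment_ge_half[of "r - 2" r] r show ?thesis
    by simp
qed

lemma truncated_drop_ge:
  assumes r: "\<rho> + 2 \<le> r" and s: "s \<le> r"
  shows "\<psi>' r * (s - r) \<le> max (- 1) (\<psi> (max \<rho> s) - \<psi> r)"
proof (cases "r - 2 \<le> s")
  case True
  then have "\<psi> r - \<psi> s \<le> \<psi>' r * (r - s)"
    using r s by (intro increment_le) auto
  then show ?thesis
    using True r by (simp add: max_absorb2 algebra_simps)
next
  case False
  then have "1 / 2 * 2 \<le> \<psi>' r * (r - s)"
    using deriv_ge_half[of r] r by (intro mult_mono) auto
  then show ?thesis
    by (simp add: algebra_simps)
qed

lemma bellman_linear_beyond_threshold:
  assumes "z \<in> {0..1}" "\<rho> + 2 \<le> leading_term k z" "1 / 2 \<le> a"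
  shows "bellman unif01 (\<lambda>x. a * leading_term k x) z
    = a * leading_term k z + linear_gain a (leading_term k z) / real k"
proof -
  have "1 / a \<le> 2"
    using assms(3) by (simp add: field_simps)
  moreover have "k \<ge> 1"
    using assms(2) threshold_pos by (cases k) auto
  ultimately show ?thesis
    using assms threshold_pos by (intro bellman_linear_leading_term) auto
qed

lemma
  fixes r :: real
  assumes z: "z \<in> {0..1}" and r: "leading_term k z = r" "\<rho> + 2 \<le> r"
  shows bellman_profile_le: "bellman unif01 (profile k) z \<le> \<psi> r + linear_gain (\<psi>' (r - 2)) r / real k"
    and bellman_profile_ge: "\<psi> r + linear_gain (\<psi>' r) r / real k \<le> bellman unif01 (profile k) z"
proof -
  have le: "leading_term k x \<le> r" if "z < x" for x
    using that r leading_term_antimono[of z x k] by simp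
  have z_eq: "profile k z = \<psi> r"
    using r by (simp add: profile_eq)
  have integrable_linear: "integrable unif01 (\<lambda>x. a * leading_term k x)" for a
    using integrable_leading_term by simp
  have linear: "bellman unif01 (\<lambda>x. \<psi>' s * leading_term k x) z - \<psi>' s * r = linear_gain (\<psi>' s) r / real k"
    if "\<rho> \<le> s" for s
    using bellman_linear_beyond_threshold[OF z] deriv_ge_half[OF that] r by simp
  have "bellman unif01 (profile k) z - profile k z
      \<le> bellman unif01 (\<lambda>x. \<psi>' (r - 2) * leading_term k x) z - \<psi>' (r - 2) * leading_term k z"
    using truncated_drop_le[OF r(2) le] r(1) z_eq
    by (intro unif01.bellman_gain_mono integrable_profile integrable_linear always_eventually)
      (simp add: profile_def right_diff_distrib)
  then show "bellman unif01 (profile k) z \<le> \<psi> r + linear_gain (\<psi>' (r - 2)) r / real k"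
    using linear[of "r - 2"] r z_eq by simp
  have "bellman unif01 (\<lambda>x. \<psi>' r * leading_term k x) z - \<psi>' r * leading_term k z
      \<le> bellman unif01 (profile k) z - profile k z"
    using truncated_drop_ge[OF r(2) le] r(1) z_eq
    by (intro unif01.bellman_gain_mono integrable_profile integrable_linear always_eventually)
      (simp add: profile_def right_diff_distrib)
  then show "\<psi> r + linear_gain (\<psi>' r) r / real k \<le> bellman unif01 (profile k) z"
    using linear[of r] r z_eq by simp
qed

lemma bellman_profile_le_profile_Suc:
  fixes r :: real
  assumes z: "z \<in> {0..1}" and r: "leading_term k z = r" "\<rho> + 2 \<le> r"
    and super: "linear_gain (\<psi>' (r - 2)) r * (2 * r + 1 / r) \<le> \<psi>' r * r\<^sup>2"
  shows "bellman unif01 (profile k) z \<le> profile (Suc k) z"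
proof -
  define q where "q = leading_term (Suc k) z"
  have r_pos: "0 < r"
    using r threshold_pos by simp
  then have q: "r \<le> q" "q \<le> r + 1 / r" "q - r = r\<^sup>2 / (q + r) / real k"
    using leading_term_Suc_bounds[OF z, of k] leading_term_Suc_diff[OF z, of k] r by (auto simp: q_def)
  have "0 < 2 * r + 1 / r"
    using r_pos by (intro add_pos_pos) auto
  then have "linear_gain (\<psi>' (r - 2)) r \<le> \<psi>' r * (r\<^sup>2 / (2 * r + 1 / r))"
    using super by (simp add: pos_le_divide_eq)
  also have "\<dots> \<le> \<psi>' r * (r\<^sup>2 / (q + r))"
    using q r_pos r deriv_ge_half[of r] by (intro mult_left_mono divide_left_mono) auto
  finally have "linear_gain (\<psi>' (r - 2)) r / real k \<le> \<psi>' r * (r\<^sup>2 / (q + r)) / real k"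
    by (rule divide_right_mono) simp
  also have "\<dots> = \<psi>' r * (q - r)"
    by (simp add: q(3))
  also have "\<dots> \<le> \<psi> q - \<psi> r"
    using q r by (intro increment_ge) auto
  finally show ?thesis
    using bellman_profile_le[OF z r] profile_eq[of "Suc k" z] q(1) r(2) by (simp add: q_def)
qed

lemma profile_Suc_le_bellman_profile:
  fixes r :: real
  assumes z: "z \<in> {0..1}" and r: "leading_term k z = r" "\<rho> + 2 \<le> r"
    and sub: "\<psi>' (r + 1 / r) * r \<le> 2 * linear_gain (\<psi>' r) r"
  shows "profile (Suc k) z \<le> bellman unif01 (profile k) z"
proof -
  define q where "q = leading_term (Suc k) z"
  have r_pos: "0 < r"
    using r threshold_pos by simp
  then have q: "r \<le> q" "q \<le> r + 1 / r" "q - r = r\<^sup>2 / (q + r) / real k"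
    using leading_term_Suc_bounds[OF z, of k] leading_term_Suc_diff[OF z, of k] r by (auto simp: q_def)
  have "\<psi> q - \<psi> r \<le> \<psi>' q * (q - r)"
    using q r by (intro increment_le) auto
  also have "\<dots> = \<psi>' q * (r\<^sup>2 / (q + r)) / real k"
    by (simp add: q(3))
  also have "\<dots> \<le> linear_gain (\<psi>' r) r / real k"
  proof (rule divide_right_mono)
    have "\<psi>' q * (r\<^sup>2 / (q + r)) \<le> \<psi>' (r + 1 / r) * (r\<^sup>2 / (2 * r))"
      using q r r_pos deriv_ge_half[of "r + 1 / r"]
      by (intro mult_mono deriv_mono divide_left_mono) auto
    also have "\<dots> \<le> linear_gain (\<psi>' r) r"
      using sub r_pos by (simp add: power2_eq_square)
    finally show "\<psi>' q * (r\<^sup>2 / (q + r)) \<le> linear_gain (\<psi>' r) r" .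
  qed simp
  finally show ?thesis
    using bellman_profile_ge[OF z r] profile_eq[of "Suc k" z] q(1) r(2) by (simp add: q_def)
qed

lemma opt_value_le_profile_of_leading_term_le:
  assumes z: "z \<in> {0..1}" and "leading_term k z \<le> R"
  shows "opt_value unif01 k z \<le> (R\<^sup>2 / 2 - \<psi> \<rho>) + profile k z"
proof -
  have "opt_value unif01 k z \<le> (leading_term k z)\<^sup>2 / 2"
    using z by (rule opt_value_unif01_le)
  also have "\<dots> \<le> R\<^sup>2 / 2"
    using assms by (intro divide_right_mono power_mono) (auto simp: leading_term_def)
  also have "\<dots> \<le> (R\<^sup>2 / 2 - \<psi> \<rho>) + profile k z"
    using profile_mono[of \<rho> "max \<rho> (leading_term k z)"] by (simp add: profile_def)
  finally show ?thesis .
qed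

proposition opt_value_le_profile:
  assumes "eventually (\<lambda>r. linear_gain (\<psi>' (r - 2)) r * (2 * r + 1 / r) \<le> \<psi>' r * r\<^sup>2) at_top"
  obtains K where "\<And>k z. z \<in> {0..1} \<Longrightarrow> opt_value unif01 k z \<le> K + profile k z"
proof -
  have "eventually (\<lambda>r. \<rho> + 2 \<le> r \<and>
      linear_gain (\<psi>' (r - 2)) r * (2 * r + 1 / r) \<le> \<psi>' r * r\<^sup>2) at_top"
    using assms eventually_ge_at_top by (intro eventually_conj)
  then obtain R where R: "\<And>r. R \<le> r \<Longrightarrow> \<rho> + 2 \<le> r"
      "\<And>r. R \<le> r \<Longrightarrow> linear_gain (\<psi>' (r - 2)) r * (2 * r + 1 / r) \<le> \<psi>' r * r\<^sup>2"
    unfolding eventually_at_top_linorder by blast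
  define K where "K = (R + 1)\<^sup>2 / 2 - \<psi> \<rho>"

  have "opt_value unif01 k z \<le> K + profile k z" if "z \<in> {0..1}" for k z
  proof (rule unif01.opt_value_le_supersolution[where S = "{0..1}" and g = "\<lambda>k z. K + profile k z"])
    show "AE x in unif01. x \<in> {0..1}"
      using AE_unif01 by eventually_elim auto
    show "integrable unif01 (\<lambda>z. K + profile k z)" for k
      using integrable_profile by simp
    show "0 \<le> K + profile 0 z" if "z \<in> {0..1}" for z
      using opt_value_le_profile_of_leading_term_le[OF that, of 0 "R + 1"] R(1)[of R] threshold_pos
      by (simp add: K_def)
    show "opt_value unif01 (Suc k) z \<le> K + profile (Suc k) z
        \<or> bellman unif01 (\<lambda>x. K + profile k x) z \<le> K + profile (Suc k) z"
      if z: "z \<in> {0..1}" for k z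
    proof (cases "leading_term (Suc k) z \<le> R + 1")
      case True
      then show ?thesis
        unfolding K_def using opt_value_le_profile_of_leading_term_le[OF z] by blast
    next
      case False
      then have "R \<le> leading_term k z"
        using z R(1)[of R] threshold_pos by (intro leading_term_ge_of_Suc) auto
      from bellman_profile_le_profile_Suc[OF z refl R[OF this]] show ?thesis
        by (simp add: unif01.bellman_add_const integrable_profile)
    qed
  qed fact
  then show thesis
    by (rule that)
qed

proposition opt_value_ge_profile:
  assumes "eventually (\<lambda>r. \<psi>' (r + 1 / r) * r \<le> 2 * linear_gain (\<psi>' r) r) at_top"
  obtains K where "\<And>k z. z \<in> {0..1} \<Longrightarrow> - K + profile k z \<le> opt_value unif01 k z"
proof -
  have "eventually (\<lambda>r. \<rho> + 2 \<le> r \<and> \<psi>' (r + 1 / r) * r \<le> 2 * linear_gain (\<psi>' r) r) at_top"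
    using assms eventually_ge_at_top by (intro eventually_conj)
  then obtain R where R: "\<And>r. R \<le> r \<Longrightarrow> \<rho> + 2 \<le> r"
      "\<And>r. R \<le> r \<Longrightarrow> \<psi>' (r + 1 / r) * r \<le> 2 * linear_gain (\<psi>' r) r"
    unfolding eventually_at_top_linorder by blast
  define K where "K = \<psi> (R + 1)"
  have profile_le: "profile k z \<le> K" if "leading_term k z \<le> R + 1" for k z
    unfolding profile_def K_def using that R(1)[of R] by (intro profile_mono) auto
  have "- K + profile k z \<le> opt_value unif01 k z" if "z \<in> {0..1}" for k z
  proof (rule unif01.opt_value_ge_subsolution[where S = "{0..1}" and g = "\<lambda>k z. - K + profile k z"])
    show "AE x in unif01. x \<in> {0..1}"
      using AE_unif01 by eventually_elim auto
    show "integrable unif01 (\<lambda>z. - K + profile k z)" for k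
      using integrable_profile by simp
    show "- K + profile 0 z \<le> 0" for z
      using profile_le[of 0 z] R(1)[of R] threshold_pos by simp
    show "- K + profile (Suc k) z \<le> opt_value unif01 (Suc k) z
        \<or> - K + profile (Suc k) z \<le> bellman unif01 (\<lambda>x. - K + profile k x) z"
      if z: "z \<in> {0..1}" for k z
    proof (cases "leading_term (Suc k) z \<le> R + 1")
      case True
      then show ?thesis
        using profile_le[of "Suc k" z] unif01.opt_value_bounds(1)[of "Suc k" z] by linarith
    next
      case False
      then have "R \<le> leading_term k z"
        using z R(1)[of R] threshold_pos by (intro leading_term_ge_of_Suc) auto
      from profile_Suc_le_bellman_profile[OF z refl R[OF this]] show ?thesis
        by (simp add: unif01.bellman_add_const[where c = "- K", simplified] integrable_profile)
    qed
  qed fact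
  then show thesis
    by (rule that)
qed

end

section \<open>Asymptotics of the dynamic programming values\<close>

definition barrier :: "real \<Rightarrow> real \<Rightarrow> real" where
  "barrier c r = r - ln r / 6 + c / r"

definition barrier_deriv :: "real \<Rightarrow> real \<Rightarrow> real" where
  "barrier_deriv c r = 1 - 1 / (6 * r) - c / r\<^sup>2"

lemma DERIV_barrier: "0 < r \<Longrightarrow> (barrier c has_real_derivative barrier_deriv c r) (at r)"
  unfolding barrier_def [abs_def] barrier_deriv_def
  by (auto intro!: derivative_eq_intros simp: power2_eq_square field_simps)

lemma barrier_deriv_mono:
  assumes "\<bar>c\<bar> \<le> 1" "12 \<le> s" "s \<le> r"
  shows "barrier_deriv c s \<le> barrier_deriv c r"
proof -
  have inv: "0 \<le> 1 / r" "1 / r \<le> 1 / s" "1 / s \<le> 1 / 12"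
    using assms by (auto intro!: divide_left_mono)
  then have "1 / r + 1 / s \<le> 1 / 6"
    by linarith
  with inv have "\<bar>c\<bar> * (1 / r + 1 / s) \<le> 1 * (1 / 6)"
    using assms by (intro mult_mono add_nonneg_nonneg) auto
  then have "0 \<le> 1 / 6 + c * (1 / r + 1 / s)"
    using abs_ge_minus_self[of "c * (1 / r + 1 / s)"] inv by (simp add: abs_mult)
  then have "0 \<le> (1 / s - 1 / r) * (1 / 6 + c * (1 / r + 1 / s))"
    using inv by (intro mult_nonneg_nonneg) auto
  also have "\<dots> = barrier_deriv c r - barrier_deriv c s"
    by (simp add: barrier_deriv_def power2_eq_square algebra_simps)
  finally show ?thesis
    by simp
qed

lemma barrier_deriv_ge_half:
  assumes "\<bar>c\<bar> \<le> 1" "12 \<le> r"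
  shows "1 / 2 \<le> barrier_deriv c r"
proof -
  have "1 / (6 * r) \<le> 1 / (6 * 12)"
    using assms by (intro divide_left_mono) auto
  moreover have "c / r\<^sup>2 \<le> 1 / 12\<^sup>2"
    using assms by (intro frac_le power_mono) auto
  ultimately show ?thesis
    by (simp add: barrier_deriv_def)
qed

lemma convex_profile_barrier: "\<bar>c\<bar> \<le> 1 \<Longrightarrow> convex_profile (barrier c) (barrier_deriv c) 12"
  by standard (use barrier_deriv_ge_half in \<open>auto intro: DERIV_barrier barrier_deriv_mono\<close>)

lemma barrier_supersolution:
  "eventually (\<lambda>r. linear_gain (barrier_deriv (- 1) (r - 2)) r * (2 * r + 1 / r)
    \<le> barrier_deriv (- 1) r * r\<^sup>2) at_top"
  unfolding linear_gain_def barrier_deriv_def by real_asymp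

lemma barrier_subsolution:
  "eventually (\<lambda>r. barrier_deriv 1 (r + 1 / r) * r \<le> 2 * linear_gain (barrier_deriv 1 r) r) at_top"
  unfolding linear_gain_def barrier_deriv_def by real_asymp

lemma Bseq_barrier:
  "Bseq (\<lambda>n. barrier c (max 12 (sqrt (2 * real n))) - sqrt (2 * real n) + ln (real n) / 12)"
proof (rule convergent_imp_Bseq, rule convergentI)
  have "(\<lambda>n. barrier c (sqrt (2 * real n)) - sqrt (2 * real n) + ln (real n) / 12) \<longlonglongrightarrow> - ln 2 / 12"
    unfolding barrier_def by real_asymp
  moreover have "eventually (\<lambda>n. 12 \<le> sqrt (2 * real n)) sequentially"
    by real_asymp
  ultimately show "(\<lambda>n. barrier c (max 12 (sqrt (2 * real n))) - sqrt (2 * real n) + ln (real n) / 12)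
      \<longlonglongrightarrow> - ln 2 / 12"
    by (rule Lim_transform_eventually[OF _ eventually_mono]) (simp add: max_absorb2)
qed

theorem Bseq_opt_value: "Bseq (\<lambda>n. opt_value unif01 n 0 - sqrt (2 * real n) + ln (real n) / 12)"
proof -
  interpret upper: convex_profile "barrier (- 1)" "barrier_deriv (- 1)" 12
    by (rule convex_profile_barrier) simp
  interpret lower: convex_profile "barrier 1" "barrier_deriv 1" 12
    by (rule convex_profile_barrier) simp
  obtain K where K: "\<And>k z. z \<in> {0..1} \<Longrightarrow> opt_value unif01 k z \<le> K + upper.profile k z"
    using upper.opt_value_le_profile[OF barrier_supersolution] by blast
  obtain L where L: "\<And>k z. z \<in> {0..1} \<Longrightarrow> - L + lower.profile k z \<le> opt_value unif01 k z"
    using lower.opt_value_ge_profile[OF barrier_subsolution] by blast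
  obtain A where A: "\<And>n. \<bar>upper.profile n 0 - sqrt (2 * real n) + ln (real n) / 12\<bar> \<le> A"
    using Bseq_barrier[of "- 1"] by (auto simp: upper.profile_def leading_term_def Bseq_def)
  obtain B where B: "\<And>n. \<bar>lower.profile n 0 - sqrt (2 * real n) + ln (real n) / 12\<bar> \<le> B"
    using Bseq_barrier[of 1] by (auto simp: lower.profile_def leading_term_def Bseq_def)
  show ?thesis
  proof (rule BseqI'[where K = "\<bar>K\<bar> + \<bar>L\<bar> + A + B"])
    show "norm (opt_value unif01 n 0 - sqrt (2 * real n) + ln (real n) / 12) \<le> \<bar>K\<bar> + \<bar>L\<bar> + A + B" for n
      using K[of 0 n] L[of 0 n] A[of n] B[of n] by auto
  qed
qed

section \<open>Acceptance sequences\<close>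

primrec num_accepted :: "(nat \<Rightarrow> 'a \<Rightarrow> bool) \<Rightarrow> nat \<Rightarrow> 'a \<Rightarrow> nat" where
  "num_accepted s 0 = (\<lambda>\<omega>. 0)"
| "num_accepted s (Suc i) = (\<lambda>\<omega>. num_accepted s i \<omega> + (if s (Suc i) \<omega> then 1 else 0))"

primrec last_accepted ::
    "(nat \<Rightarrow> 'a \<Rightarrow> bool) \<Rightarrow> (nat \<Rightarrow> 'a \<Rightarrow> real) \<Rightarrow> real \<Rightarrow> nat \<Rightarrow> 'a \<Rightarrow> real" where
  "last_accepted s X z 0 = (\<lambda>\<omega>. z)"
| "last_accepted s X z (Suc i) = (\<lambda>\<omega>. if s (Suc i) \<omega> then X (Suc i) \<omega> else last_accepted s X z i \<omega>)"

definition increasing_acceptance ::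
    "(nat \<Rightarrow> 'a \<Rightarrow> bool) \<Rightarrow> (nat \<Rightarrow> 'a \<Rightarrow> real) \<Rightarrow> real \<Rightarrow> nat \<Rightarrow> 'a \<Rightarrow> bool" where
  "increasing_acceptance s X z n \<omega> \<longleftrightarrow>
     (\<forall>i<n. s (Suc i) \<omega> \<longrightarrow> last_accepted s X z i \<omega> < X (Suc i) \<omega>)"

lemma num_accepted_mono: "i \<le> j \<Longrightarrow> num_accepted s i \<omega> \<le> num_accepted s j \<omega>"
  by (rule lift_Suc_mono_le[of "\<lambda>i. num_accepted s i \<omega>"]) auto

lemma num_accepted_le: "num_accepted s i \<omega> \<le> i"
  by (induction i) auto

lemma num_accepted_eq_card: "num_accepted s i \<omega> = card {l \<in> {1..i}. s l \<omega>}"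
proof (induction i)
  case (Suc i)
  have "{l \<in> {1..Suc i}. s l \<omega>} = {l \<in> {1..i}. s l \<omega>} \<union> (if s (Suc i) \<omega> then {Suc i} else {})"
    by (auto simp: le_Suc_eq)
  with Suc show ?case
    by simp
qed simp

lemma last_accepted_cases:
  obtains "last_accepted s X z i \<omega> = z"
  | p where "p \<in> {1..i}" "s p \<omega>" "last_accepted s X z i \<omega> = X p \<omega>"
proof -
  have "last_accepted s X z i \<omega> = z \<or> (\<exists>p\<in>{1..i}. s p \<omega> \<and> last_accepted s X z i \<omega> = X p \<omega>)"
  proof (induction i)
    case (Suc i)
    then show ?case
      by (cases "s (Suc i) \<omega>") (auto intro: bexI[of _ "Suc i"])
  qed simp
  then show thesis
    using that by blast
qed

lemma increasing_acceptance_values_less: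
  assumes incr: "increasing_acceptance s X z n \<omega>"
    and p: "1 \<le> p" "s p \<omega>" and q: "p < q" "q \<le> n" "s q \<omega>"
  shows "X p \<omega> < X q \<omega>"
proof -
  obtain i where i: "q = Suc i"
    using q(1) by (cases q) auto
  have "X p \<omega> = last_accepted s X z p \<omega>"
    using p by (cases p) auto
  also have "\<dots> \<le> last_accepted s X z i \<omega>"
  proof (rule lift_Suc_mono_le_ivl[of "{p..<i}" "\<lambda>i. last_accepted s X z i \<omega>"])
    show "last_accepted s X z l \<omega> \<le> last_accepted s X z (Suc l) \<omega>" if "l \<in> {p..<i}" for l
      using incr that q(2) by (simp add: increasing_acceptance_def less_imp_le i)
  qed (use q(1) i in auto)
  also have "\<dots> < X q \<omega>"
    using incr q by (simp add: increasing_acceptance_def i)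
  finally show ?thesis .
qed

definition policy_accepts :: "(nat \<Rightarrow> 'a \<Rightarrow> enat) \<Rightarrow> nat \<Rightarrow> 'a \<Rightarrow> bool" where
  "policy_accepts \<tau> i \<omega> \<longleftrightarrow> (\<exists>j\<ge>1. \<tau> j \<omega> = enat i)"

lemma selection_policyD:
  assumes "selection_policy M X n \<tau>" "\<omega> \<in> space M" "1 \<le> j"
  shows "\<tau> j \<omega> \<in> enat ` {1..n} \<union> {\<infinity>}"
    and "\<tau> j \<omega> < \<tau> (Suc j) \<omega> \<or> (\<tau> j \<omega> = \<infinity> \<and> \<tau> (Suc j) \<omega> = \<infinity>)"
    and "\<tau> (Suc j) \<omega> \<noteq> \<infinity> \<Longrightarrow> X (the_enat (\<tau> j \<omega>)) \<omega> < X (the_enat (\<tau> (Suc j) \<omega>)) \<omega>"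
  using assms unfolding selection_policy_def by blast+

lemma selection_policy_strict_mono:
  assumes "selection_policy M X n \<tau>" "\<omega> \<in> space M" "1 \<le> j" "j < l" "\<tau> l \<omega> \<noteq> \<infinity>"
  shows "\<tau> j \<omega> < \<tau> l \<omega>" and "X (the_enat (\<tau> j \<omega>)) \<omega> < X (the_enat (\<tau> l \<omega>)) \<omega>"
proof -
  have Suc_l: "\<tau> l \<omega> < \<tau> (Suc l) \<omega>" "X (the_enat (\<tau> l \<omega>)) \<omega> < X (the_enat (\<tau> (Suc l) \<omega>)) \<omega>"
    if "1 \<le> l" "\<tau> (Suc l) \<omega> \<noteq> \<infinity>" for l
    using selection_policyD(2,3)[OF assms(1,2) that(1)] that(2) by auto
  from \<open>j < l\<close> have "Suc j \<le> l"
    by simp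
  then have "\<tau> j \<omega> < \<tau> l \<omega> \<and> X (the_enat (\<tau> j \<omega>)) \<omega> < X (the_enat (\<tau> l \<omega>)) \<omega>"
    using assms(5)
  proof (induction l rule: dec_induct)
    case base
    then show ?case
      using Suc_l[of j] assms(3) by simp
  next
    case (step l)
    then have "\<tau> l \<omega> < \<tau> (Suc l) \<omega>" "X (the_enat (\<tau> l \<omega>)) \<omega> < X (the_enat (\<tau> (Suc l) \<omega>)) \<omega>"
      using Suc_l[of l] by auto
    moreover from this(1) have "\<tau> l \<omega> \<noteq> \<infinity>"
      by (cases "\<tau> l \<omega>") auto
    ultimately show ?case
      using step.IH by auto
  qed
  then show "\<tau> j \<omega> < \<tau> l \<omega>" "X (the_enat (\<tau> j \<omega>)) \<omega> < X (the_enat (\<tau> l \<omega>)) \<omega>"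
    by auto
qed

lemma policy_accepts_values_less:
  assumes pol: "selection_policy M X n \<tau>" "\<omega> \<in> space M"
    and p: "policy_accepts \<tau> p \<omega>" and q: "policy_accepts \<tau> q \<omega>" and "p < q"
  shows "X p \<omega> < X q \<omega>"
proof -
  obtain j l where j: "1 \<le> j" "\<tau> j \<omega> = enat p" and l: "1 \<le> l" "\<tau> l \<omega> = enat q"
    using p q by (auto simp: policy_accepts_def)
  have "\<not> l \<le> j"
    using selection_policy_strict_mono(1)[OF pol l(1), of j] j l \<open>p < q\<close> by (auto simp: le_less)
  then show ?thesis
    using selection_policy_strict_mono(2)[OF pol j(1), of l] j l by simp
qed

lemma increasing_acceptance_policy_accepts:
  assumes pol: "selection_policy M X n \<tau>" "\<omega> \<in> space M" and z: "\<forall>i\<in>{1..n}. z < X i \<omega>"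
  shows "increasing_acceptance (policy_accepts \<tau>) X z n \<omega>"
  unfolding increasing_acceptance_def
proof (intro allI impI)
  fix i assume i: "i < n" "policy_accepts \<tau> (Suc i) \<omega>"
  show "last_accepted (policy_accepts \<tau>) X z i \<omega> < X (Suc i) \<omega>"
  proof (cases rule: last_accepted_cases[of "policy_accepts \<tau>" X z i \<omega>])
    case 1
    then show ?thesis
      using z i by auto
  next
    case (2 p)
    then show ?thesis
      using policy_accepts_values_less[OF pol _ i(2), of p] by auto
  qed
qed

lemma le_num_accepted_of_policy_time_le:
  assumes pol: "selection_policy M X n \<tau>" "\<omega> \<in> space M" and j: "\<tau> j \<omega> \<le> enat n"
  shows "j \<le> num_accepted (policy_accepts \<tau>) n \<omega>"
proof -
  let ?A = "{l \<in> {1..n}. policy_accepts \<tau> l \<omega>}"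
  have "\<tau> j \<omega> \<noteq> \<infinity>"
    using j by (cases "\<tau> j \<omega>") auto
  then have finite_time: "\<tau> i \<omega> \<noteq> \<infinity>" if "i \<in> {1..j}" for i
    using selection_policy_strict_mono(1)[OF pol, of i j] that by (cases "i = j"; cases "\<tau> i \<omega>") auto
  have "inj_on (\<lambda>i. \<tau> i \<omega>) {1..j}"
  proof (rule linorder_inj_onI)
    fix i i' assume "i < i'" "i \<in> {1..j}" "i' \<in> {1..j}"
    then show "\<tau> i \<omega> \<noteq> \<tau> i' \<omega>"
      using selection_policy_strict_mono(1)[OF pol, of i i'] finite_time[of i'] by auto
  qed auto
  moreover have "(\<lambda>i. \<tau> i \<omega>) ` {1..j} \<subseteq> enat ` ?A"
  proof clarify
    fix i assume i: "i \<in> {1..j}"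
    then have "\<tau> i \<omega> \<in> enat ` {1..n}"
      using selection_policyD(1)[OF pol, of i] finite_time[of i] by auto
    then show "\<tau> i \<omega> \<in> enat ` ?A"
      using i by (auto simp: policy_accepts_def)
  qed
  ultimately have "card {1..j} \<le> card (enat ` ?A)"
    by (intro card_inj_on_le) auto
  then show ?thesis
    by (simp add: num_accepted_eq_card card_image inj_on_def)
qed

lemma selected_length_le_num_accepted:
  assumes "selection_policy M X n \<tau>" "\<omega> \<in> space M"
  shows "selected_length n \<tau> \<omega> \<le> num_accepted (policy_accepts \<tau>) n \<omega>"
proof -
  have "{j. 1 \<le> j \<and> \<tau> j \<omega> \<le> enat n} \<subseteq> {..num_accepted (policy_accepts \<tau>) n \<omega>}"
    using le_num_accepted_of_policy_time_le[OF assms] by auto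
  then show ?thesis
    unfolding selected_length_def by (subst Max_le_iff) (auto intro: finite_subset)
qed

definition acceptance_time :: "(nat \<Rightarrow> 'a \<Rightarrow> bool) \<Rightarrow> nat \<Rightarrow> nat \<Rightarrow> 'a \<Rightarrow> enat" where
  "acceptance_time s n j \<omega> =
     (if j \<le> num_accepted s n \<omega> then enat (LEAST i. j \<le> num_accepted s i \<omega>) else \<infinity>)"

lemma acceptance_time_le_iff:
  "acceptance_time s n j \<omega> \<le> enat i \<longleftrightarrow> j \<le> num_accepted s (min i n) \<omega>"
proof
  assume "acceptance_time s n j \<omega> \<le> enat i"
  then have j: "j \<le> num_accepted s n \<omega>" and le: "(LEAST i. j \<le> num_accepted s i \<omega>) \<le> i"
    by (auto simp: acceptance_time_def split: if_splits)
  have "j \<le> num_accepted s (LEAST i. j \<le> num_accepted s i \<omega>) \<omega>"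
    using j by (rule LeastI)
  also have "\<dots> \<le> num_accepted s i \<omega>"
    using le by (rule num_accepted_mono)
  finally show "j \<le> num_accepted s (min i n) \<omega>"
    using j by (simp add: min_def)
next
  assume j: "j \<le> num_accepted s (min i n) \<omega>"
  then have "j \<le> num_accepted s n \<omega>"
    by (rule order_trans) (simp add: num_accepted_mono)
  moreover have "(LEAST i. j \<le> num_accepted s i \<omega>) \<le> min i n"
    using j by (rule Least_le)
  ultimately show "acceptance_time s n j \<omega> \<le> enat i"
    by (simp add: acceptance_time_def)
qed

lemma acceptance_time_finite:
  assumes "1 \<le> j" "acceptance_time s n j \<omega> \<noteq> \<infinity>"
  obtains p where "p < n" "acceptance_time s n j \<omega> = enat (Suc p)" "s (Suc p) \<omega>"
    "num_accepted s (Suc p) \<omega> = j"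
proof -
  obtain i where i: "acceptance_time s n j \<omega> = enat i"
    using assms(2) by auto
  have i_iff: "i \<le> l \<longleftrightarrow> j \<le> num_accepted s (min l n) \<omega>" for l
    using acceptance_time_le_iff[of s n j \<omega> l] by (simp add: i)
  have "i \<noteq> 0"
    using i_iff[of 0] assms(1) by auto
  then obtain p where p: "i = Suc p"
    by (cases i) auto
  have "i \<le> n"
    using i_iff[of i] i_iff[of n] by (cases "i \<le> n") auto
  then have "j \<le> num_accepted s (Suc p) \<omega>" "\<not> j \<le> num_accepted s p \<omega>"
    using i_iff[of "Suc p"] i_iff[of p] by (auto simp: p min_def)
  with \<open>i \<le> n\<close> i show thesis
    by (intro that[of p]) (auto simp: p split: if_splits)
qed

lemma acceptance_time_less_Suc:
  assumes "acceptance_time s n (Suc j) \<omega> \<noteq> \<infinity>"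
  shows "acceptance_time s n j \<omega> < acceptance_time s n (Suc j) \<omega>"
proof -
  obtain p where p: "p < n" "acceptance_time s n (Suc j) \<omega> = enat (Suc p)" "s (Suc p) \<omega>"
      "num_accepted s (Suc p) \<omega> = Suc j"
    using acceptance_time_finite[OF _ assms] by auto
  then have "acceptance_time s n j \<omega> \<le> enat p"
    by (simp add: acceptance_time_le_iff)
  also have "\<dots> < acceptance_time s n (Suc j) \<omega>"
    by (simp add: p)
  finally show ?thesis .
qed

lemma selected_length_acceptance_time:
  "selected_length n (acceptance_time s n) \<omega> = num_accepted s n \<omega>"
proof -
  have "insert 0 {j. 1 \<le> j \<and> acceptance_time s n j \<omega> \<le> enat n} = {0..num_accepted s n \<omega>}"
    by (auto simp: acceptance_time_le_iff)
  then show ?thesis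
    unfolding selected_length_def by (auto intro: Max_eqI)
qed

lemma acceptance_time_values_less:
  assumes incr: "increasing_acceptance s X z n \<omega>"
    and j: "1 \<le> j" "acceptance_time s n (Suc j) \<omega> \<noteq> \<infinity>"
  shows "X (the_enat (acceptance_time s n j \<omega>)) \<omega> < X (the_enat (acceptance_time s n (Suc j) \<omega>)) \<omega>"
proof -
  have less: "acceptance_time s n j \<omega> < acceptance_time s n (Suc j) \<omega>"
    using j(2) by (rule acceptance_time_less_Suc)
  then have "acceptance_time s n j \<omega> \<noteq> \<infinity>"
    by (cases "acceptance_time s n j \<omega>") auto
  with j(1) obtain p where p: "acceptance_time s n j \<omega> = enat (Suc p)" "s (Suc p) \<omega>"
    by (rule acceptance_time_finite)
  obtain q where q: "q < n" "acceptance_time s n (Suc j) \<omega> = enat (Suc q)" "s (Suc q) \<omega>"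
    using acceptance_time_finite[OF _ j(2)] by auto
  show ?thesis
    using increasing_acceptance_values_less[OF incr _ p(2) _ _ q(3)] p q less by simp
qed

section \<open>The filtration generated by the items\<close>

lemma space_item_filtration [simp]: "space (item_filtration M X n t) = space M"
  unfolding item_filtration_def by (intro space_measure_of) auto

lemma sets_item_filtration: "sets (item_filtration M X n t) =
    sigma_sets (space M) (\<Union>i\<in>{i\<in>{1..n}. enat i \<le> t}. {X i -` B \<inter> space M | B. B \<in> sets borel})"
proof -
  have "{X i -` B \<inter> space M | i B. i \<in> {1..n} \<and> enat i \<le> t \<and> B \<in> sets borel} =
      (\<Union>i\<in>{i\<in>{1..n}. enat i \<le> t}. {X i -` B \<inter> space M | B. B \<in> sets borel})"
    by blast
  then show ?thesis
    unfolding item_filtration_def by (subst sets_measure_of) auto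
qed

lemma filtration_item_filtration: "filtration (space M) (item_filtration M X n)"
proof
  fix t t' :: enat assume "t \<le> t'"
  then show "sets (item_filtration M X n t) \<subseteq> sets (item_filtration M X n t')"
    unfolding sets_item_filtration by (intro sigma_sets_mono' UN_mono) (auto intro: order_trans)
qed simp

lemma measurable_item_filtration_mono:
  assumes "f \<in> measurable (item_filtration M X n t) N" "t \<le> t'"
  shows "f \<in> measurable (item_filtration M X n t') N"
proof (rule measurable_from_subalg[OF _ assms(1)])
  show "subalgebra (item_filtration M X n t') (item_filtration M X n t)"
    using filtration.sets_F_mono[OF filtration_item_filtration assms(2)] by (simp add: subalgebra_def)
qed

lemma measurable_item_item_filtration:
  assumes "i \<in> {1..n}" "enat i \<le> t"
  shows "X i \<in> borel_measurable (item_filtration M X n t)"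
proof (rule measurableI)
  fix B :: "real set" assume "B \<in> sets borel"
  then show "X i -` B \<inter> space (item_filtration M X n t) \<in> sets (item_filtration M X n t)"
    unfolding space_item_filtration sets_item_filtration using assms by (intro sigma_sets.Basic) blast
qed simp

lemma selection_policy_acceptance_time:
  assumes incr: "\<And>\<omega>. \<omega> \<in> space M \<Longrightarrow> increasing_acceptance s X z n \<omega>"
    and meas: "\<And>i. i \<le> n \<Longrightarrow>
      num_accepted s i \<in> measurable (item_filtration M X n (enat i)) (count_space UNIV)"
  shows "selection_policy M X n (acceptance_time s n)"
  unfolding selection_policy_def
proof (intro conjI allI impI ballI)
  fix j :: nat assume j: "1 \<le> j"
  show "stopping_time (item_filtration M X n) (acceptance_time s n j)"
  proof
    fix t
    show "Measurable.pred (item_filtration M X n t) (\<lambda>\<omega>. acceptance_time s n j \<omega> \<le> t)"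
    proof (cases t)
      case (enat i)
      have [measurable]: "num_accepted s (min i n) \<in> measurable (item_filtration M X n (enat i)) (count_space UNIV)"
        by (rule measurable_item_filtration_mono[OF meas]) auto
      show ?thesis
        unfolding enat acceptance_time_le_iff by measurable
    qed simp
  qed
  fix \<omega> assume \<omega>: "\<omega> \<in> space M"
  show "acceptance_time s n j \<omega> \<in> enat ` {1..n} \<union> {\<infinity>}"
  proof (cases "acceptance_time s n j \<omega> = \<infinity>")
    case False
    with j obtain p where "p < n" "acceptance_time s n j \<omega> = enat (Suc p)"
      by (rule acceptance_time_finite)
    then show ?thesis
      by simp
  qed simp
  show "acceptance_time s n j \<omega> < acceptance_time s n (Suc j) \<omega> \<or>
      acceptance_time s n j \<omega> = \<infinity> \<and> acceptance_time s n (Suc j) \<omega> = \<infinity>"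
    using acceptance_time_less_Suc[of s n j \<omega>]
    by (cases "acceptance_time s n (Suc j) \<omega>"; cases "acceptance_time s n j \<omega>") auto
  show "X (the_enat (acceptance_time s n j \<omega>)) \<omega> < X (the_enat (acceptance_time s n (Suc j) \<omega>)) \<omega>"
    if "acceptance_time s n (Suc j) \<omega> \<noteq> \<infinity>"
    using incr[OF \<omega>] j that by (rule acceptance_time_values_less)
qed

section \<open>The optimal expected length for independent identically distributed items\<close>

lemma (in prob_space) expectation_indep_var:
  fixes h :: "'b \<times> 'b \<Rightarrow> real"
  assumes indep: "indep_var S Z T Y" and h [measurable]: "h \<in> borel_measurable (S \<Otimes>\<^sub>M T)"
    and int: "integrable M (\<lambda>\<omega>. h (Z \<omega>, Y \<omega>))"
  shows "expectation (\<lambda>\<omega>. h (Z \<omega>, Y \<omega>)) = expectation (\<lambda>\<omega>. \<integral>y. h (Z \<omega>, y) \<partial>distr M T Y)"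
proof -
  have [measurable]: "random_variable S Z" "random_variable T Y"
    and pair: "distr M (S \<Otimes>\<^sub>M T) (\<lambda>\<omega>. (Z \<omega>, Y \<omega>)) = distr M S Z \<Otimes>\<^sub>M distr M T Y"
    using indep unfolding indep_var_distribution_eq by auto
  interpret Z: prob_space "distr M S Z"
    by (rule prob_space_distr) simp
  interpret Y: prob_space "distr M T Y"
    by (rule prob_space_distr) simp
  interpret ZY: pair_prob_space "distr M S Z" "distr M T Y" ..
  have "integrable (distr M S Z \<Otimes>\<^sub>M distr M T Y) h"
    using int unfolding pair[symmetric] by (simp add: integrable_distr_eq)
  note fubini = ZY.integral_fst'[OF this]
  have "expectation (\<lambda>\<omega>. h (Z \<omega>, Y \<omega>)) = integral\<^sup>L (distr M S Z \<Otimes>\<^sub>M distr M T Y) h"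
    unfolding pair[symmetric] by (simp add: integral_distr)
  also have "\<dots> = (\<integral>z. \<integral>y. h (z, y) \<partial>distr M T Y \<partial>distr M S Z)"
    by (rule fubini[symmetric])
  also have "\<dots> = expectation (\<lambda>\<omega>. \<integral>y. h (Z \<omega>, y) \<partial>distr M T Y)"
    by (intro integral_distr Y.borel_measurable_lebesgue_integral) simp_all
  finally show ?thesis .
qed

locale iid_items = prob_space M + law: real_distribution D
  for M :: "'a measure" and D :: "real measure" +
  fixes X :: "nat \<Rightarrow> 'a \<Rightarrow> real" and n :: nat
  assumes indep_items: "indep_vars (\<lambda>_. borel) X {1..n}"
    and distr_item: "i \<in> {1..n} \<Longrightarrow> distr M borel (X i) = D"
begin

abbreviation filt :: "nat \<Rightarrow> 'a measure" where
  "filt i \<equiv> item_filtration M X n (enat i)"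

lemma measurable_item: "i \<in> {1..n} \<Longrightarrow> X i \<in> borel_measurable M"
  using indep_items by (auto simp: indep_vars_def)

lemma measurable_filt: "f \<in> measurable (filt i) N \<Longrightarrow> f \<in> measurable M N"
proof (rule measurable_from_subalg)
  show "subalgebra M (filt i)"
    by (auto simp: subalgebra_def sets_item_filtration intro!: sets.sigma_sets_subset measurable_sets[OF measurable_item])
qed

lemma AE_item:
  assumes "AE x in D. P x" "i \<in> {1..n}"
  shows "AE \<omega> in M. P (X i \<omega>)"
  using AE_distrD[OF measurable_item[OF assms(2)], of P] assms(1) unfolding distr_item[OF assms(2)] .

lemma indep_set_past_item:
  assumes l: "l \<in> {i<..n}"
  shows "indep_set (sets (filt i)) (sigma_sets (space M) {X l -` B \<inter> space M | B. B \<in> sets borel})"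
proof -
  let ?E = "\<lambda>j. {X j -` B \<inter> space M | B. B \<in> sets borel}" and ?I = "case_bool {1..i} {l}"
  have "indep_sets (\<lambda>b. sigma_sets (space M) (\<Union>j\<in>?I b. ?E j)) UNIV"
  proof (rule indep_sets_collect_sigma)
    have "indep_sets ?E {1..n}"
      using indep_items unfolding indep_vars_def2 by simp
    then show "indep_sets ?E (\<Union>b. ?I b)"
      by (rule indep_sets_mono_index[rotated]) (use l in \<open>auto split: bool.splits\<close>)
    show "disjoint_family_on ?I UNIV"
      using l by (auto simp: disjoint_family_on_def split: bool.splits)
    show "Int_stable (?E j)" for j
    proof (rule Int_stableI, clarify)
      fix B C :: "real set" assume "B \<in> sets borel" "C \<in> sets borel"
      then show "\<exists>A. X j -` B \<inter> space M \<inter> (X j -` C \<inter> space M) = X j -` A \<inter> space M \<and> A \<in> sets borel"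
        by (intro exI[of _ "B \<inter> C"]) auto
    qed
  qed
  moreover have "{j \<in> {1..n}. enat j \<le> enat i} = {1..i}"
    using l by auto
  then have "(\<lambda>b. sigma_sets (space M) (\<Union>j\<in>?I b. ?E j)) = case_bool (sets (filt i)) (sigma_sets (space M) (?E l))"
    unfolding sets_item_filtration by (simp add: fun_eq_iff split: bool.split)
  ultimately show ?thesis
    by (simp add: indep_set_def)
qed

lemma indep_var_past_item:
  assumes Z: "Z \<in> measurable (filt i) N" and l: "l \<in> {i<..n}"
  shows "indep_var N Z borel (X l)"
proof -
  have "sigma_sets (space M) {Z -` A \<inter> space M | A. A \<in> sets N} \<subseteq> sets (filt i)"
    using measurable_sets[OF Z] by (intro sets.sigma_sets_subset[of _ "filt i", simplified]) auto
  then have "indep_set (sigma_sets (space M) {Z -` A \<inter> space M | A. A \<in> sets N})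
      (sigma_sets (space M) {X l -` B \<inter> space M | B. B \<in> sets borel})"
    using indep_set_past_item[OF l] unfolding indep_sets2_eq by blast
  then show ?thesis
    using measurable_filt[OF Z] measurable_item[of l] l by (simp add: indep_var_eq)
qed

lemma expectation_choice_value:
  assumes Z: "Z \<in> borel_measurable (filt i)" and i: "i < n"
    and f [measurable]: "f \<in> borel_measurable borel" and bound: "\<And>x. \<bar>f x\<bar> \<le> B"
  shows "integrable M (\<lambda>\<omega>. choice_value f (Z \<omega>) (X (Suc i) \<omega>))"
    and "expectation (\<lambda>\<omega>. choice_value f (Z \<omega>) (X (Suc i) \<omega>)) = expectation (\<lambda>\<omega>. bellman D f (Z \<omega>))"
proof -
  have [measurable]: "Z \<in> borel_measurable M" "X (Suc i) \<in> borel_measurable M"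
    using measurable_filt[OF Z] measurable_item[of "Suc i"] i by auto
  show int: "integrable M (\<lambda>\<omega>. choice_value f (Z \<omega>) (X (Suc i) \<omega>))"
    by (rule integrable_const_bound[where B = "B + 1"]) (auto intro!: abs_choice_value_le bound)
  have "indep_var borel Z borel (X (Suc i))"
    using i by (intro indep_var_past_item[OF Z]) auto
  from expectation_indep_var[OF this, of "\<lambda>(z, x). choice_value f z x"] int i
  show "expectation (\<lambda>\<omega>. choice_value f (Z \<omega>) (X (Suc i) \<omega>)) = expectation (\<lambda>\<omega>. bellman D f (Z \<omega>))"
    by (simp add: bellman_def distr_item split_beta')
qed

definition adapted :: "(nat \<Rightarrow> 'a \<Rightarrow> bool) \<Rightarrow> nat \<Rightarrow> bool" where
  "adapted s m \<longleftrightarrow> (\<forall>i\<in>{1..m}. Measurable.pred (filt i) (s i))"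

lemma measurable_num_accepted:
  assumes "adapted s i"
  shows "num_accepted s i \<in> measurable (filt i) (count_space UNIV)"
  using assms
proof (induction i)
  case (Suc i)
  then have [measurable]: "Measurable.pred (filt (Suc i)) (s (Suc i))"
    "num_accepted s i \<in> measurable (filt (Suc i)) (count_space UNIV)"
    by (auto simp: adapted_def intro: measurable_item_filtration_mono)
  show ?case
    unfolding num_accepted.simps by measurable
qed simp

lemma measurable_last_accepted:
  assumes "adapted s i" "i \<le> n"
  shows "last_accepted s X z i \<in> borel_measurable (filt i)"
  using assms
proof (induction i)
  case (Suc i)
  then have [measurable]: "Measurable.pred (filt (Suc i)) (s (Suc i))"
    "last_accepted s X z i \<in> borel_measurable (filt (Suc i))"
    by (auto simp: adapted_def intro: measurable_item_filtration_mono)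
  have [measurable]: "X (Suc i) \<in> borel_measurable (filt (Suc i))"
    using Suc.prems by (intro measurable_item_item_filtration) auto
  show ?case
    unfolding last_accepted.simps by measurable
qed simp

lemma adapted_le: "adapted s m \<Longrightarrow> i \<le> m \<Longrightarrow> adapted s i"
  by (simp add: adapted_def)

definition potential :: "(nat \<Rightarrow> 'a \<Rightarrow> bool) \<Rightarrow> real \<Rightarrow> nat \<Rightarrow> 'a \<Rightarrow> real" where
  "potential s z i \<omega> = num_accepted s i \<omega> + opt_value D (n - i) (last_accepted s X z i \<omega>)"

definition choice_potential :: "(nat \<Rightarrow> 'a \<Rightarrow> bool) \<Rightarrow> real \<Rightarrow> nat \<Rightarrow> 'a \<Rightarrow> real" where
  "choice_potential s z i \<omega> =
     num_accepted s i \<omega> + choice_value (opt_value D (n - Suc i)) (last_accepted s X z i \<omega>) (X (Suc i) \<omega>)"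

lemma integrable_num_accepted:
  assumes "adapted s i"
  shows "integrable M (\<lambda>\<omega>. real (num_accepted s i \<omega>))"
  using measurable_filt[OF measurable_num_accepted[OF assms]] num_accepted_le[of s i]
  by (intro integrable_const_bound[where B = i]) auto

lemma integrable_opt_value_last_accepted:
  assumes "adapted s i" "i \<le> n"
  shows "integrable M (\<lambda>\<omega>. opt_value D k (last_accepted s X z i \<omega>))"
  using measurable_filt[OF measurable_last_accepted[OF assms]] law.abs_opt_value_le[of k]
  by (intro integrable_const_bound[where B = k]) auto

lemma integrable_potential: "adapted s i \<Longrightarrow> i \<le> n \<Longrightarrow> integrable M (potential s z i)"
  unfolding potential_def [abs_def]
  by (intro Bochner_Integration.integrable_add integrable_num_accepted integrable_opt_value_last_accepted)

lemma
  assumes s: "adapted s i" and i: "i < n"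
  shows integrable_choice_potential: "integrable M (choice_potential s z i)"
    and expectation_choice_potential: "expectation (choice_potential s z i) = expectation (potential s z i)"
proof -
  have last: "last_accepted s X z i \<in> borel_measurable (filt i)"
    using s i by (intro measurable_last_accepted) auto
  note choice = expectation_choice_value[OF last i law.measurable_opt_value law.abs_opt_value_le, of "n - Suc i"]
  show "integrable M (choice_potential s z i)"
    unfolding choice_potential_def [abs_def]
    by (intro Bochner_Integration.integrable_add integrable_num_accepted[OF s] choice(1))
  have "n - i = Suc (n - Suc i)"
    using i by simp
  then have "opt_value D (n - i) = bellman D (opt_value D (n - Suc i))"
    by simp
  with choice integrable_num_accepted[OF s] integrable_opt_value_last_accepted[OF s, of "n - i" z] i
  show "expectation (choice_potential s z i) = expectation (potential s z i)"
    by (simp add: choice_potential_def [abs_def] potential_def [abs_def])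
qed

lemma expectation_num_accepted_le:
  assumes s: "adapted s n" and incr: "AE \<omega> in M. increasing_acceptance s X z n \<omega>"
  shows "expectation (\<lambda>\<omega>. num_accepted s n \<omega>) \<le> opt_value D n z"
proof -
  have "expectation (potential s z i) \<le> opt_value D n z" if "i \<le> n" for i
    using that
  proof (induction i)
    case 0
    then show ?case
      by (simp add: potential_def [abs_def] prob_space)
  next
    case (Suc i)
    then have i: "i < n" and adapted: "adapted s i" "adapted s (Suc i)"
      using s by (auto intro: adapted_le)
    have "expectation (potential s z (Suc i)) \<le> expectation (choice_potential s z i)"
    proof (rule integral_mono_AE)
      show "AE \<omega> in M. potential s z (Suc i) \<omega> \<le> choice_potential s z i \<omega>"
        using incr by eventually_elim
          (use i in \<open>auto simp: potential_def choice_potential_def choice_value_def increasing_acceptance_def\<close>)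
    qed (use adapted i in \<open>auto intro: integrable_potential integrable_choice_potential\<close>)
    then show ?case
      using Suc expectation_choice_potential[OF adapted(1) i] by simp
  qed
  from this[of n] show ?thesis
    by (simp add: potential_def [abs_def])
qed

definition worth_accepting :: "nat \<Rightarrow> real \<Rightarrow> real \<Rightarrow> bool" where
  "worth_accepting i z x \<longleftrightarrow> z < x \<and> opt_value D (n - i) z \<le> opt_value D (n - i) x + 1"

lemma expectation_num_accepted_eq:
  assumes s: "adapted s n"
    and greedy: "\<And>i \<omega>. i < n \<Longrightarrow>
      s (Suc i) \<omega> \<longleftrightarrow> worth_accepting (Suc i) (last_accepted s X z i \<omega>) (X (Suc i) \<omega>)"
  shows "expectation (\<lambda>\<omega>. num_accepted s n \<omega>) = opt_value D n z"
proof -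
  have "expectation (potential s z i) = opt_value D n z" if "i \<le> n" for i
    using that
  proof (induction i)
    case 0
    then show ?case
      by (simp add: potential_def [abs_def] prob_space)
  next
    case (Suc i)
    then have i: "i < n" and adapted: "adapted s i"
      using s by (auto intro: adapted_le)
    have "potential s z (Suc i) = choice_potential s z i"
      using greedy[OF i]
      by (auto simp: potential_def choice_potential_def choice_value_def worth_accepting_def fun_eq_iff max_def)
    then show ?case
      using Suc expectation_choice_potential[OF adapted i] by simp
  qed
  from this[of n] show ?thesis
    by (simp add: potential_def [abs_def])
qed

lemma adapted_policy_accepts:
  assumes "selection_policy M X n \<tau>"
  shows "adapted (policy_accepts \<tau>) m"
  unfolding adapted_def
proof
  fix i
  have "Measurable.pred (filt i) (\<lambda>\<omega>. 1 \<le> j \<and> \<tau> j \<omega> = enat i)" for j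
  proof (cases "1 \<le> j")
    case True
    then have "stopping_time (item_filtration M X n) (\<tau> j)"
      using assms by (simp add: selection_policy_def)
    from filtration.stopping_time_eq_const[OF filtration_item_filtration this] True show ?thesis
      by simp
  qed simp
  then show "Measurable.pred (filt i) (policy_accepts \<tau> i)"
    unfolding policy_accepts_def [abs_def] by (rule pred_intros_countable)
qed

lemma expectation_selected_length_le:
  assumes pol: "selection_policy M X n \<tau>" and z: "AE x in D. z < x"
  shows "expectation (\<lambda>\<omega>. selected_length n \<tau> \<omega>) \<le> opt_value D n z"
proof -
  note adapted = adapted_policy_accepts[OF pol, of n]
  have "AE \<omega> in M. \<forall>i\<in>{1..n}. z < X i \<omega>"
    using z by (intro AE_finite_allI AE_item) auto
  with AE_space have "AE \<omega> in M. increasing_acceptance (policy_accepts \<tau>) X z n \<omega>"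
    by eventually_elim (rule increasing_acceptance_policy_accepts[OF pol])
  with adapted have "expectation (\<lambda>\<omega>. num_accepted (policy_accepts \<tau>) n \<omega>) \<le> opt_value D n z"
    by (rule expectation_num_accepted_le)
  moreover have "expectation (\<lambda>\<omega>. selected_length n \<tau> \<omega>) \<le> expectation (\<lambda>\<omega>. num_accepted (policy_accepts \<tau>) n \<omega>)"
    using integrable_num_accepted[OF adapted] selected_length_le_num_accepted[OF pol]
    by (intro integral_mono') auto
  ultimately show ?thesis
    by simp
qed

primrec greedy_level :: "real \<Rightarrow> nat \<Rightarrow> 'a \<Rightarrow> real" where
  "greedy_level z 0 = (\<lambda>\<omega>. z)"
| "greedy_level z (Suc i) = (\<lambda>\<omega>.
     if worth_accepting (Suc i) (greedy_level z i \<omega>) (X (Suc i) \<omega>) then X (Suc i) \<omega> else greedy_level z i \<omega>)"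

definition greedy_accepts :: "real \<Rightarrow> nat \<Rightarrow> 'a \<Rightarrow> bool" where
  "greedy_accepts z i \<omega> \<longleftrightarrow> worth_accepting i (greedy_level z (i - 1) \<omega>) (X i \<omega>)"

lemma last_accepted_greedy: "last_accepted (greedy_accepts z) X z i = greedy_level z i"
  by (induction i) (auto simp: greedy_accepts_def)

lemma greedy_accepts_Suc:
  "greedy_accepts z (Suc i) \<omega> \<longleftrightarrow>
     worth_accepting (Suc i) (last_accepted (greedy_accepts z) X z i \<omega>) (X (Suc i) \<omega>)"
  unfolding last_accepted_greedy by (simp add: greedy_accepts_def)

lemma adapted_greedy: "i \<le> n \<Longrightarrow> adapted (greedy_accepts z) i"
proof (induction i)
  case (Suc i)
  have [measurable]: "X (Suc i) \<in> borel_measurable (filt (Suc i))"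
    using Suc.prems by (intro measurable_item_item_filtration) auto
  have [measurable]: "last_accepted (greedy_accepts z) X z i \<in> borel_measurable (filt (Suc i))"
    using Suc by (intro measurable_item_filtration_mono[OF measurable_last_accepted]) auto
  have "Measurable.pred (filt (Suc i)) (greedy_accepts z (Suc i))"
    unfolding greedy_accepts_Suc [abs_def] worth_accepting_def by measurable
  with Suc show ?case
    by (auto simp: adapted_def le_Suc_eq)
qed (simp add: adapted_def)

theorem max_expected_length_eq_opt_value:
  assumes "AE x in D. z < x"
  shows "max_expected_length M X n = opt_value D n z"
proof -
  let ?\<tau> = "acceptance_time (greedy_accepts z) n"
  have "increasing_acceptance (greedy_accepts z) X z n \<omega>" for \<omega>
    by (simp add: increasing_acceptance_def greedy_accepts_Suc worth_accepting_def)
  then have "selection_policy M X n ?\<tau>"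
    by (intro selection_policy_acceptance_time measurable_num_accepted adapted_greedy)
  moreover have "expectation (\<lambda>\<omega>. selected_length n ?\<tau> \<omega>) = opt_value D n z"
    unfolding selected_length_acceptance_time
    by (intro expectation_num_accepted_eq adapted_greedy greedy_accepts_Suc) simp
  ultimately show ?thesis
    unfolding max_expected_length_def
    using expectation_selected_length_le[OF _ assms]
    by (intro cSup_eq_maximum) (auto intro!: image_eqI[of _ _ ?\<tau>])
qed

end

lemma max_expected_length_uniform:
  assumes "iid_uniform_items M X n"
  shows "max_expected_length M X n = opt_value unif01 n 0"
proof -
  interpret prob_space M
    using assms by (simp add: iid_uniform_items_def)
  interpret iid_items M unif01 X n
    using assms by unfold_locales (auto simp: iid_uniform_items_def)
  have "AE x in unif01. 0 < x"
    using AE_unif01 by eventually_elim simp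
  then show ?thesis
    by (rule max_expected_length_eq_opt_value)
qed

theorem theorem3p2:
  fixes M :: "nat \<Rightarrow> 'a measure"
    and X :: "nat \<Rightarrow> nat \<Rightarrow> 'a \<Rightarrow> real"
  assumes "\<And>n. n \<ge> 1 \<Longrightarrow> iid_uniform_items (M n) (X n) n"
  shows "bdd_above ((\<lambda>n. \<bar>max_expected_length (M n) (X n) n - sqrt (2 * real n) + ln (real n) / 12\<bar>) ` {1..})"
proof -
  obtain C where "\<And>n. \<bar>opt_value unif01 n 0 - sqrt (2 * real n) + ln (real n) / 12\<bar> \<le> C"
    using Bseq_opt_value by (auto simp: Bseq_def)
  moreover have "max_expected_length (M n) (X n) n = opt_value unif01 n 0" if "n \<ge> 1" for n
    using assms[OF that] by (rule max_expected_length_uniform)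
  ultimately show ?thesis
    by (intro bdd_aboveI[of _ C]) auto
qed

end
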